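(* For every integer $n\ge 0$, $$|RAI_{2n}(3412)|=|AI_{2n+2}(3412)|=|AI_{2n+1}(3412)|=|RAI_{2n+1}(3412)|=M_n,$$ where $M_n$ is the $n$-th Motzkin number.
   Context: Let $S_n$ be the set of permutations $\pi=\pi_1\ldots\pi_n$ of $\{1,\ldots,n\}$ (for $n=0$, only the empty permutation). A permutation is alternating if, for all $1\le i\le n-1$, $\pi_i<\pi_{i+1}$ if and only if $i$ is odd; it is reverse alternating if, for all $1\le i\le n-1$, $\pi_i>\pi_{i+1}$ if and only if $i$ is odd. $AI_n$ (resp. $RAI_n$) is the set of alternating (resp. reverse alternating) involutions ($\pi=\pi^{-1}$) in $S_n$. A permutation $\pi\in S_n$ avoids the pattern $\tau\in S_k$ if there are no indices $i_1<\cdots<i_k$ such that $\pi_{i_1}\ldots\pi_{i_k}$ is order-isomorphic to $\tau$; $AI_n(\tau)$ and $RAI_n(\tau)$ are the subsets of elements avoiding $\tau$. The Motzkin number $M_n$ is the number of Motzkin paths of length $n$, i.e. lattice paths from $(0,0)$ to $(n,0)$ with steps $U=(1,1)$, $D=(1,-1)$, $H=(1,0)$ that stay weakly above the $x$-axis (so $M_0=M_1=1$, $M_2=2$, $M_3=4$). *)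

theory Defs
  imports "HOL-Combinatorics.Permutations" "HOL-Library.Product_Plus"
begin

text \<open>
  A permutation \<open>\<pi>\<close> of \<open>{1..n}\<close> is a function \<open>nat \<Rightarrow> nat\<close> with \<open>\<pi> permutes {1..n}\<close>: it is the
  identity outside \<open>{1..n}\<close>, so these functions correspond one-to-one to the words
  \<open>\<pi> 1 \<dots> \<pi> n\<close>. For \<open>n = 0\<close> there is exactly one, the identity.
\<close>

definition alternating :: "nat \<Rightarrow> (nat \<Rightarrow> nat) \<Rightarrow> bool" where
  "alternating n \<pi> \<longleftrightarrow> (\<forall>i\<in>{1..<n}. \<pi> i < \<pi> (i + 1) \<longleftrightarrow> odd i)"

definition reverse_alternating :: "nat \<Rightarrow> (nat \<Rightarrow> nat) \<Rightarrow> bool" where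
  "reverse_alternating n \<pi> \<longleftrightarrow> (\<forall>i\<in>{1..<n}. \<pi> i > \<pi> (i + 1) \<longleftrightarrow> odd i)"

definition AI :: "nat \<Rightarrow> (nat \<Rightarrow> nat) set" where
  "AI n = {\<pi>. \<pi> permutes {1..n} \<and> \<pi> = inv \<pi> \<and> alternating n \<pi>}"

definition RAI :: "nat \<Rightarrow> (nat \<Rightarrow> nat) set" where
  "RAI n = {\<pi>. \<pi> permutes {1..n} \<and> \<pi> = inv \<pi> \<and> reverse_alternating n \<pi>}"

text \<open>
  A pattern is given by its one-line notation \<open>\<tau>\<close>. The function \<open>f\<close> lists the indices
  \<open>f 0 < f 1 < \<dots> < f (k - 1)\<close> of an occurrence, where \<open>k\<close> is the length of \<open>\<tau>\<close>; its
  values at arguments \<open>\<ge> k\<close> play no role.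
\<close>

definition contains_pattern :: "nat \<Rightarrow> (nat \<Rightarrow> nat) \<Rightarrow> nat list \<Rightarrow> bool" where
  "contains_pattern n \<pi> \<tau> \<longleftrightarrow>
     (\<exists>f :: nat \<Rightarrow> nat.
        strict_mono_on {..<length \<tau>} f \<and> f ` {..<length \<tau>} \<subseteq> {1..n} \<and>
        (\<forall>a<length \<tau>. \<forall>b<length \<tau>. \<pi> (f a) < \<pi> (f b) \<longleftrightarrow> \<tau> ! a < \<tau> ! b))"

definition AI_avoiding :: "nat \<Rightarrow> nat list \<Rightarrow> (nat \<Rightarrow> nat) set" where
  "AI_avoiding n \<tau> = {\<pi> \<in> AI n. \<not> contains_pattern n \<pi> \<tau>}"

definition RAI_avoiding :: "nat \<Rightarrow> nat list \<Rightarrow> (nat \<Rightarrow> nat) set" where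
  "RAI_avoiding n \<tau> = {\<pi> \<in> RAI n. \<not> contains_pattern n \<pi> \<tau>}"

text \<open>
  A lattice path starting at the origin is the list of its steps, as vectors added componentwise;
  the point reached after \<open>k\<close> steps is the sum of the first \<open>k\<close> entries.
\<close>

definition motzkin_paths :: "nat \<Rightarrow> (int \<times> int) list set" where
  "motzkin_paths n =
     {w. set w \<subseteq> {(1, 1), (1, - 1), (1, 0)} \<and> sum_list w = (int n, 0) \<and>
         (\<forall>k\<le>length w. snd (sum_list (take k w)) \<ge> 0)}"

definition motzkin :: "nat \<Rightarrow> nat" where
  "motzkin n = card (motzkin_paths n)"

end

theory Submission
  imports Defs
begin

text \<open>
  An involution avoids \<open>3412\<close> exactly when its two-cycles, drawn as arcs, do not cross. A noncrossing
  involution \<open>\<pi>\<close> is determined by its word of signs \<open>sgn (\<pi> i - i)\<close>, and the words that arise are the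
  Motzkin words. In such a word there is a descent at \<open>i\<close> exactly when position \<open>i\<close> opens an arc or
  position \<open>i + 1\<close> closes one. Hence, if the descents are the positions of one parity, the word
  consists of pairs \<open>(1, -1)\<close>, \<open>(1, 0)\<close>, \<open>(0, -1)\<close>, preceded and followed by at most one \<open>0\<close>. Replacing
  each pair by its sum gives an arbitrary Motzkin path with one step per pair.
\<close>

section \<open>Noncrossing involutions\<close>

definition noncrossing_involutions :: "nat \<Rightarrow> (nat \<Rightarrow> nat) set" where
  "noncrossing_involutions m =
     {\<pi>. \<pi> permutes {1..m} \<and> \<pi> = inv \<pi> \<and> (\<forall>i j. \<not> (i < j \<and> j < \<pi> i \<and> \<pi> i < \<pi> j))}"

lemma involution_apply:
  assumes "\<pi> permutes S" "\<pi> = inv \<pi>"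
  shows "\<pi> (\<pi> x) = x"
  by (metis assms permutes_inverses(1))

lemma contains_3412_iff:
  "contains_pattern m \<pi> [3, 4, 1, 2] \<longleftrightarrow>
     (\<exists>i j k l. 1 \<le> i \<and> i < j \<and> j < k \<and> k < l \<and> l \<le> m \<and> \<pi> k < \<pi> l \<and> \<pi> l < \<pi> i \<and> \<pi> i < \<pi> j)"
    (is "?lhs \<longleftrightarrow> ?rhs")
proof
  have len: "length [3, 4, 1, 2 :: nat] = 4" by simp
  {
    assume ?lhs
    then obtain f :: "nat \<Rightarrow> nat" where f: "strict_mono_on {..<4} f" "f ` {..<4} \<subseteq> {1..m}"
      and order: "\<forall>a<4. \<forall>b<4. \<pi> (f a) < \<pi> (f b) \<longleftrightarrow> [3, 4, 1, 2::nat] ! a < [3, 4, 1, 2] ! b"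
      unfolding contains_pattern_def len by blast
    have "f 0 < f 1" "f 1 < f 2" "f 2 < f 3"
      using f(1) by (simp_all add: strict_mono_on_def)
    moreover have "1 \<le> f 0" "f 3 \<le> m"
      using f(2) by (simp_all add: image_subset_iff)
    moreover have "\<pi> (f 2) < \<pi> (f 3)" "\<pi> (f 3) < \<pi> (f 0)" "\<pi> (f 0) < \<pi> (f 1)"
      using order[rule_format, of 2 3] order[rule_format, of 3 0] order[rule_format, of 0 1]
      by (simp_all add: eval_nat_numeral)
    ultimately show ?rhs by blast
  }
  assume ?rhs
  then obtain i j k l where ijkl: "1 \<le> i" "i < j" "j < k" "k < l" "l \<le> m"
    "\<pi> k < \<pi> l" "\<pi> l < \<pi> i" "\<pi> i < \<pi> j" by blast
  define f where "f a = [i, j, k, l] ! a" for a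
  have less4: "a < 4 \<longleftrightarrow> a = 0 \<or> a = 1 \<or> a = 2 \<or> a = 3" for a :: nat
    by linarith
  have f: "f 0 = i" "f 1 = j" "f 2 = k" "f 3 = l"
    by (simp_all add: f_def eval_nat_numeral)
  have "f a < f b" if "a < 4" "b < 4" "a < b" for a b
    using that ijkl by (auto simp: less4 f f(2)[unfolded One_nat_def])
  then have "strict_mono_on {..<4} f"
    by (simp add: strict_mono_on_def)
  moreover have "f a \<in> {1..m}" if "a < 4" for a
    using that ijkl by (auto simp: less4 f f(2)[unfolded One_nat_def])
  then have "f ` {..<4} \<subseteq> {1..m}" by blast
  moreover have "\<pi> (f a) < \<pi> (f b) \<longleftrightarrow> [3, 4, 1, 2::nat] ! a < [3, 4, 1, 2] ! b" if "a < 4" "b < 4" for a b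
    using that ijkl
    by (auto simp: less4 f f(2)[unfolded One_nat_def])
  ultimately show ?lhs
    unfolding contains_pattern_def len by blast
qed

text \<open>In an occurrence i < j < k < l of 3412, the arcs opening at i and j cross if j < \<pi>
  i. Otherwise \<pi> l < \<pi> i \<le> j < k, so the arcs ending at k and l cross. Conversely, the
  four ends of two crossing arcs form an occurrence.\<close>

lemma avoids_3412_iff_noncrossing:
  assumes perm: "\<pi> permutes {1..m}" and "\<pi> = inv \<pi>"
  shows "\<not> contains_pattern m \<pi> [3, 4, 1, 2] \<longleftrightarrow> (\<forall>i j. \<not> (i < j \<and> j < \<pi> i \<and> \<pi> i < \<pi> j))"
proof -
  note inv = involution_apply[OF assms]
  have "\<exists>i j. i < j \<and> j < \<pi> i \<and> \<pi> i < \<pi> j" if "contains_pattern m \<pi> [3, 4, 1, 2]"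
  proof -
    from that obtain i j k l where ijkl: "i < j" "j < k" "k < l"
      "\<pi> k < \<pi> l" "\<pi> l < \<pi> i" "\<pi> i < \<pi> j" unfolding contains_3412_iff by blast
    show ?thesis
    proof (cases "j < \<pi> i")
      case True
      with ijkl show ?thesis by blast
    next
      case False
      with ijkl have "\<pi> k < \<pi> l" "\<pi> l < \<pi> (\<pi> k)" "\<pi> (\<pi> k) < \<pi> (\<pi> l)"
        by (simp_all add: inv)
      then show ?thesis by blast
    qed
  qed
  moreover have "contains_pattern m \<pi> [3, 4, 1, 2]" if "i < j" "j < \<pi> i" "\<pi> i < \<pi> j" for i j
  proof -
    have moved: "x \<in> {1..m}" if "\<pi> x \<noteq> x" for x
      using permutes_not_in[OF perm, of x] that by blast
    have "1 \<le> i" "\<pi> j \<le> m"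
      using moved[of i] moved[of "\<pi> j"] that by (auto simp: inv)
    then show ?thesis
      unfolding contains_3412_iff using that
      by (intro exI[of _ i] exI[of _ j] exI[of _ "\<pi> i"] exI[of _ "\<pi> j"]) (simp add: inv)
  qed
  ultimately show ?thesis by blast
qed

section \<open>Sign words\<close>

definition dirs :: "(nat \<Rightarrow> nat) \<Rightarrow> nat \<Rightarrow> int" where
  "dirs \<pi> i = sgn (int (\<pi> i) - int i)"

definition height :: "(nat \<Rightarrow> int) \<Rightarrow> nat \<Rightarrow> int" where
  "height s j = (\<Sum>i=1..j. s i)"

definition motzkin_words :: "nat \<Rightarrow> (nat \<Rightarrow> int) set" where
  "motzkin_words m =
     {s. (\<forall>i. s i \<in> {-1, 0, 1}) \<and> (\<forall>i. i \<notin> {1..m} \<longrightarrow> s i = 0) \<and>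
         (\<forall>j. 0 \<le> height s j) \<and> height s m = 0}"

text \<open>For unit steps: an up-step at i and the down-step at j that first returns the path to
  its level before i.\<close>

definition matches :: "(nat \<Rightarrow> int) \<Rightarrow> nat \<Rightarrow> nat \<Rightarrow> bool" where
  "matches s i j \<longleftrightarrow> 1 \<le> i \<and> i < j \<and> height s j = height s (i - 1) \<and>
     (\<forall>k\<in>{i..<j}. height s j < height s k)"

definition mate :: "(nat \<Rightarrow> int) \<Rightarrow> nat \<Rightarrow> nat" where
  "mate s i = (if s i = 1 then THE j. matches s i j
               else if s i = -1 then THE j. matches s j i else i)"

lemma dirs_eq_iff:
  "dirs \<pi> i = 1 \<longleftrightarrow> i < \<pi> i" "dirs \<pi> i = -1 \<longleftrightarrow> \<pi> i < i" "dirs \<pi> i = 0 \<longleftrightarrow> \<pi> i = i"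
  by (auto simp: dirs_def sgn_if)

lemma height_0 [simp]: "height s 0 = 0"
  by (simp add: height_def)

lemma height_Suc [simp]: "height s (Suc j) = height s j + s (Suc j)"
  by (simp add: height_def)

lemma height_step: "1 \<le> i \<Longrightarrow> height s i = height s (i - 1) + s i"
  by (cases i) simp_all

lemma height_split:
  assumes "i \<le> j"
  shows "height s j = height s i + (\<Sum>k\<in>{i<..j}. s k)"
  using assms by (induction j rule: dec_induct) (simp_all add: atLeastSucAtMost_greaterThanAtMost[symmetric])

text \<open>The two ends of an arc carry opposite signs, so reindexing by \<pi> shows that the sum
  equals its own negative.\<close>

lemma sum_dirs_closed:
  assumes inv: "\<And>x. \<pi> (\<pi> x) = x" and closed: "\<And>x. x \<in> B \<Longrightarrow> \<pi> x \<in> B"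
  shows "sum (dirs \<pi>) B = 0"
proof -
  have "sum (dirs \<pi>) B = sum (\<lambda>x. dirs \<pi> (\<pi> x)) B"
    by (rule sum.reindex_bij_witness[of _ \<pi> \<pi>]) (auto simp: inv closed)
  also have "\<dots> = - sum (dirs \<pi>) B"
    unfolding sum_negf[symmetric] by (rule sum.cong) (auto simp: dirs_def inv sgn_if)
  finally show ?thesis by simp
qed

text \<open>Points with partner in B cancel. Any other point of B has its partner to the right,
  hence sign 1.\<close>

lemma sum_dirs_nonneg:
  assumes inv: "\<And>x. \<pi> (\<pi> x) = x" and "finite B"
    and closed: "\<And>x. x \<in> B \<Longrightarrow> \<pi> x < x \<Longrightarrow> \<pi> x \<in> B"
  shows "0 \<le> sum (dirs \<pi>) B"
proof -
  let ?A = "{x \<in> B. \<pi> x \<in> B}"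
  have "sum (dirs \<pi>) ?A = 0"
    by (rule sum_dirs_closed) (auto simp: inv)
  moreover have "0 \<le> sum (dirs \<pi>) (B - ?A)"
  proof (rule sum_nonneg)
    fix x assume "x \<in> B - ?A"
    then show "0 \<le> dirs \<pi> x"
      using closed[of x] by (cases "\<pi> x < x") (auto simp: dirs_def sgn_if)
  qed
  moreover have "sum (dirs \<pi>) B = sum (dirs \<pi>) (B - ?A) + sum (dirs \<pi>) ?A"
    using \<open>finite B\<close> by (intro sum.subset_diff) auto
  ultimately show ?thesis by simp
qed

section \<open>Uniqueness, noncrossing and existence of matches\<close>

lemma matches_unique_right: "matches s i j \<Longrightarrow> matches s i k \<Longrightarrow> j = k"
  unfolding matches_def by (metis atLeastLessThan_iff less_imp_le linorder_neqE_nat less_irrefl)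

lemma matches_unique_left:
  assumes "matches s i k" "matches s j k"
  shows "i = j"
proof -
  have False if "i < j" "matches s i k" "matches s j k" for i j
  proof -
    have "j - 1 \<in> {i..<k}" using that by (auto simp: matches_def)
    with that have "height s k < height s (j - 1)" unfolding matches_def by blast
    with that show False by (simp add: matches_def)
  qed
  with assms show ?thesis by (metis linorder_neqE_nat)
qed

text \<open>If the arcs crossed, k - 1 would lie inside the first and be higher than j, while j
  would lie inside the second and be higher than l, which has the height of k - 1.\<close>

lemma matches_noncrossing:
  assumes "matches s i j" "matches s k l" "i < k" "k < j"
  shows "l \<le> j"
proof (rule ccontr)
  assume "\<not> l \<le> j"
  then have "k - 1 \<in> {i..<j}" "j \<in> {k..<l}" using assms by auto
  then show False using assms unfolding matches_def by fastforce
qed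

lemma matches_signs:
  assumes "matches s i j" "\<And>k. s k \<in> {-1, 0, 1}"
  shows "s i = 1" "s j = -1"
proof -
  have "height s j < height s i" "height s j < height s (j - 1)"
    using assms(1) by (auto simp: matches_def)
  moreover have "height s i = height s j + s i" "height s j = height s (j - 1) + s j"
    using assms(1) height_step[of i s] height_step[of j s] by (auto simp: matches_def)
  ultimately show "s i = 1" "s j = -1"
    using assms(2)[of i] assms(2)[of j] by auto
qed

text \<open>The match is the first later position not above the level before i. It exists because
  the path ends at 0, and unit steps force equality of the levels.\<close>

lemma motzkin_words_matches_right:
  assumes s: "s \<in> motzkin_words m" and "s i = 1"
  obtains j where "matches s i j"
proof -
  have word: "s k \<in> {-1, 0, 1}" "0 \<le> height s k" for k
    using s by (auto simp: motzkin_words_def)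
  have i: "1 \<le> i" "i \<le> m" and total: "height s m = 0"
    using s \<open>s i = 1\<close> by (force simp: motzkin_words_def)+
  have hi: "height s i = height s (i - 1) + 1"
    using height_step[of i s] i \<open>s i = 1\<close> by simp
  have "i \<noteq> m" using hi total word(2)[of "i - 1"] by auto
  then have ex: "i < m \<and> height s m \<le> height s (i - 1)"
    using i total word(2)[of "i - 1"] by simp
  define j where "j = (LEAST j. i < j \<and> height s j \<le> height s (i - 1))"
  have j: "i < j" "height s j \<le> height s (i - 1)"
    using LeastI[of "\<lambda>j. i < j \<and> height s j \<le> height s (i - 1)", OF ex] by (auto simp: j_def)
  have above: "height s (i - 1) < height s k" if "k \<in> {i..<j}" for k
  proof (cases "k = i")
    case False
    then show ?thesis
      using not_less_Least[of k "\<lambda>j. i < j \<and> height s j \<le> height s (i - 1)"] that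
      by (auto simp: j_def)
  qed (simp add: hi)
  have "height s (i - 1) < height s (j - 1)" using above j(1) by auto
  then have "height s j = height s (i - 1)"
    using j(2) height_step[of j s] word(1)[of j] j(1) by auto
  with above i j(1) have "matches s i j" by (auto simp: matches_def)
  then show thesis by (rule that)
qed

lemma motzkin_words_matches_left:
  assumes s: "s \<in> motzkin_words m" and "s j = -1"
  obtains i where "matches s i j"
proof -
  have word: "s k \<in> {-1, 0, 1}" "0 \<le> height s k" for k
    using s by (auto simp: motzkin_words_def)
  have j: "1 \<le> j"
    using s \<open>s j = -1\<close> by (force simp: motzkin_words_def)
  have hj: "height s (j - 1) = height s j + 1"
    using height_step[of j s] j \<open>s j = -1\<close> by simp
  \<comment> \<open>The last earlier point not above the level of j is the point just before the
    matching up-step, which is therefore \<open>Suc i\<close>. The set is nonempty because the path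
    starts at 0.\<close>
  define K where "K = {k. k < j \<and> height s k \<le> height s j}"
  have "finite K" "0 \<in> K" using j word(2) by (auto simp: K_def)
  define i where "i = Max K"
  have "i \<in> K" using Max_in[OF \<open>finite K\<close>] \<open>0 \<in> K\<close> by (auto simp: i_def)
  then have i: "i < j" "height s i \<le> height s j" by (auto simp: K_def)
  have above: "height s j < height s k" if "k \<in> {Suc i..<j}" for k
  proof -
    have "k \<notin> K" using Max_ge[OF \<open>finite K\<close>, of k] that by (auto simp: i_def)
    with that show ?thesis by (simp add: K_def)
  qed
  have "i \<noteq> j - 1" using hj i by auto
  with i have "Suc i < j" by simp
  then have "height s j < height s (Suc i)" by (intro above) simp
  then have "height s i = height s j" using i word(1)[of "Suc i"] by auto
  with above \<open>Suc i < j\<close> have "matches s (Suc i) j" by (auto simp: matches_def)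
  then show thesis by (rule that)
qed

section \<open>The bijection between noncrossing involutions and Motzkin words\<close>

lemma noncrossing_involutionsD:
  assumes "\<pi> \<in> noncrossing_involutions m"
  shows "\<pi> permutes {1..m}" "\<pi> (\<pi> x) = x" "\<not> (i < j \<and> j < \<pi> i \<and> \<pi> i < \<pi> j)"
  using assms involution_apply by (auto simp: noncrossing_involutions_def)

lemma dirs_in_motzkin_words:
  assumes "\<pi> \<in> noncrossing_involutions m"
  shows "dirs \<pi> \<in> motzkin_words m"
proof -
  note \<pi> = noncrossing_involutionsD[OF assms]
  have pos: "1 \<le> \<pi> k \<longleftrightarrow> 1 \<le> k" for k
    using permutes_not_in[OF \<pi>(1), of 0] \<pi>(2)[of k] by (cases "k = 0"; cases "\<pi> k = 0") auto
  have "0 \<le> height (dirs \<pi>) j" for j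
    unfolding height_def by (rule sum_dirs_nonneg) (use \<pi>(2) pos in auto)
  moreover have "height (dirs \<pi>) m = 0"
    unfolding height_def by (rule sum_dirs_closed) (use \<pi>(2) permutes_in_image[OF \<pi>(1)] in auto)
  moreover have "dirs \<pi> i = 0" if "i \<notin> {1..m}" for i
    using permutes_not_in[OF \<pi>(1) that] by (simp add: dirs_def)
  moreover have "dirs \<pi> i \<in> {-1, 0, 1}" for i
    by (auto simp: dirs_def sgn_if)
  ultimately show ?thesis by (simp add: motzkin_words_def)
qed

text \<open>No arc leaves the interval from i to \<pi> i, so its signs sum to 0. Any arc closing
  strictly after i and before \<pi> i also opens after i, so the height never drops below that at i,
  which is one above the base level.\<close>

lemma noncrossing_matches:
  assumes "\<pi> \<in> noncrossing_involutions m" and "i < \<pi> i"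
  shows "matches (dirs \<pi>) i (\<pi> i)"
proof -
  note \<pi> = noncrossing_involutionsD[OF assms(1)]
  have i: "1 \<le> i"
    using permutes_not_in[OF \<pi>(1), of i] assms(2) by (cases i) auto
  have above: "height (dirs \<pi>) i \<le> height (dirs \<pi>) k" if "i \<le> k" "k < \<pi> i" for k
  proof -
    have "\<pi> x \<in> {i<..k}" if "x \<in> {i<..k}" "\<pi> x < x" for x
    proof -
      have "\<pi> x \<noteq> i" using \<pi>(2)[of x] that \<open>k < \<pi> i\<close> by auto
      moreover have "\<not> \<pi> x < i" using \<pi>(3)[of "\<pi> x" i] \<pi>(2)[of x] that \<open>k < \<pi> i\<close> by auto
      ultimately show ?thesis using that by auto
    qed
    then have "0 \<le> sum (dirs \<pi>) {i<..k}"
      by (intro sum_dirs_nonneg) (use \<pi>(2) in auto)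
    then show ?thesis using height_split[OF that(1), of "dirs \<pi>"] by simp
  qed
  have "\<pi> x \<in> {i..\<pi> i}" if "x \<in> {i..\<pi> i}" for x
  proof (cases "x = i \<or> x = \<pi> i")
    case False
    with that have x: "i < x" "x < \<pi> i" by auto
    show ?thesis using \<pi>(3)[of i x] \<pi>(3)[of "\<pi> x" i] \<pi>(2) x by auto
  qed (use that \<pi>(2) in auto)
  then have "sum (dirs \<pi>) {i..\<pi> i} = 0"
    by (intro sum_dirs_closed) (use \<pi>(2) in auto)
  moreover have "{i - 1<..\<pi> i} = {i..\<pi> i}" using i by auto
  ultimately have "height (dirs \<pi>) (\<pi> i) = height (dirs \<pi>) (i - 1)"
    using height_split[of "i - 1" "\<pi> i" "dirs \<pi>"] assms(2) by simp
  moreover have "height (dirs \<pi>) i = height (dirs \<pi>) (i - 1) + 1"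
    using height_step[OF i, of "dirs \<pi>"] assms(2) dirs_eq_iff(1)[of \<pi> i] by simp
  ultimately show ?thesis
    using above i assms(2) by (force simp: matches_def)
qed

text \<open>The sign at x tells on which side its partner lies, and the partner is then the unique
  match of x.\<close>

lemma inj_on_dirs: "inj_on dirs (noncrossing_involutions m)"
proof (rule inj_onI, rule ext)
  fix \<pi> \<sigma> x
  assume \<pi>: "\<pi> \<in> noncrossing_involutions m" and \<sigma>: "\<sigma> \<in> noncrossing_involutions m"
    and eq: "dirs \<pi> = dirs \<sigma>"
  note iff = dirs_eq_iff[of \<pi> x, unfolded eq] dirs_eq_iff[of \<sigma> x]
  consider "x < \<pi> x" | "\<pi> x < x" | "\<pi> x = x" by linarith
  then show "\<pi> x = \<sigma> x"
  proof cases
    case 1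
    then have "matches (dirs \<sigma>) x (\<pi> x)" "matches (dirs \<sigma>) x (\<sigma> x)"
      using noncrossing_matches[OF \<pi>, of x] noncrossing_matches[OF \<sigma>, of x] eq iff by auto
    then show ?thesis by (rule matches_unique_right)
  next
    case 2
    then have "matches (dirs \<sigma>) (\<pi> x) x" "matches (dirs \<sigma>) (\<sigma> x) x"
      using noncrossing_matches[OF \<pi>, of "\<pi> x"] noncrossing_matches[OF \<sigma>, of "\<sigma> x"] eq iff
        noncrossing_involutionsD(2)[OF \<pi>] noncrossing_involutionsD(2)[OF \<sigma>] by auto
    then show ?thesis by (rule matches_unique_left)
  next
    case 3
    then show ?thesis using iff by auto
  qed
qed

text \<open>Existence and uniqueness of matches make both \<open>THE\<close> terms of
  \<open>mate\<close> meaningful; this case rule collects all that is needed about them.\<close>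

lemma mate_cases:
  assumes s: "s \<in> motzkin_words m"
  obtains "s i = 1" "matches s i (mate s i)" "mate s (mate s i) = i"
  | "s i = -1" "matches s (mate s i) i" "mate s (mate s i) = i"
  | "s i = 0" "mate s i = i"
proof -
  have signs: "s k \<in> {-1, 0, 1}" for k
    using s by (auto simp: motzkin_words_def)
  have mate: "mate s i = j \<and> mate s j = i" if "matches s i j" for i j
  proof -
    have "(THE k. matches s i k) = j" "(THE k. matches s k j) = i"
      using that by (blast intro: the_equality matches_unique_right matches_unique_left)+
    then show ?thesis using matches_signs[OF that signs] by (simp add: mate_def)
  qed
  consider "s i = 1" | "s i = -1" | "s i = 0" using signs[of i] by auto
  then show thesis
  proof cases
    case 1
    then obtain j where j: "matches s i j" by (rule motzkin_words_matches_right[OF s])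
    with mate[OF j] 1 show ?thesis by (intro that(1)) auto
  next
    case 2
    then obtain j where j: "matches s j i" by (rule motzkin_words_matches_left[OF s])
    with mate[OF j] 2 show ?thesis by (intro that(2)) auto
  next
    case 3
    then show ?thesis by (intro that(3)) (simp_all add: mate_def)
  qed
qed

lemma dirs_mate:
  assumes s: "s \<in> motzkin_words m"
  shows "dirs (mate s) = s"
proof
  fix i
  show "dirs (mate s) i = s i"
    by (rule mate_cases[OF s, of i]) (auto simp: matches_def dirs_def)
qed

lemma mate_noncrossing:
  assumes s: "s \<in> motzkin_words m"
  shows "mate s \<in> noncrossing_involutions m"
proof -
  have inv: "mate s (mate s i) = i" for i
    by (rule mate_cases[OF s, of i]) auto
  have right: "matches s i (mate s i)" if "i < mate s i" for i
    by (rule mate_cases[OF s, of i]) (use that in \<open>auto simp: matches_def\<close>)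
  have "mate s i = i" if "i \<notin> {1..m}" for i
    using that s by (simp add: motzkin_words_def mate_def)
  then have "mate s permutes {1..m}"
    unfolding permutes_def using inv by metis
  moreover have "mate s = inv (mate s)"
    using inv by (intro inv_unique_comp[symmetric]) auto
  moreover have "\<not> (i < j \<and> j < mate s i \<and> mate s i < mate s j)" for i j
    using matches_noncrossing[OF right[of i] right[of j]] by auto
  ultimately show ?thesis unfolding noncrossing_involutions_def by blast
qed

lemma bij_betw_dirs: "bij_betw dirs (noncrossing_involutions m) (motzkin_words m)"
  unfolding bij_betw_def
proof (intro conjI inj_on_dirs equalityI subsetI)
  fix s assume "s \<in> motzkin_words m"
  then show "s \<in> dirs ` noncrossing_involutions m"
    using dirs_mate mate_noncrossing by (metis imageI)
qed (auto intro: dirs_in_motzkin_words)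

text \<open>An arc opening at i either ends at i + 1 or encloses it, and then the partner of i + 1
  stays below \<pi> i; closing at i + 1 is symmetric. In the remaining case \<pi> i \<le> i < i + 1
  \<le> \<pi> (i + 1).\<close>

lemma noncrossing_descent_iff:
  assumes "\<pi> \<in> noncrossing_involutions m"
  shows "\<pi> (Suc i) < \<pi> i \<longleftrightarrow> dirs \<pi> i = 1 \<or> dirs \<pi> (Suc i) = -1"
proof -
  note \<pi> = noncrossing_involutionsD[OF assms]
  have ne: "\<pi> (Suc i) \<noteq> \<pi> i" by (metis \<pi>(2) n_not_Suc_n)
  have "\<pi> (Suc i) < \<pi> i" if "i < \<pi> i"
  proof (cases "\<pi> i = Suc i")
    case True
    then show ?thesis using \<pi>(2)[of i] by simp
  next
    case False
    then show ?thesis using \<pi>(3)[of i "Suc i"] that ne by auto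
  qed
  moreover have "\<pi> (Suc i) < \<pi> i" if "\<pi> (Suc i) < Suc i"
  proof (cases "\<pi> (Suc i) = i")
    case True
    then show ?thesis using \<pi>(2)[of "Suc i"] by simp
  next
    case False
    then show ?thesis using \<pi>(3)[of "\<pi> i" "\<pi> (Suc i)"] \<pi>(2) that ne by auto
  qed
  ultimately show ?thesis unfolding dirs_eq_iff by linarith
qed

section \<open>Alternating words and Motzkin paths\<close>

text \<open>The offset \<open>c\<close> is \<open>0\<close> for reverse alternating and \<open>1\<close> for alternating involutions.\<close>

definition alternating_words :: "nat \<Rightarrow> nat \<Rightarrow> (nat \<Rightarrow> int) set" where
  "alternating_words c m =
     {s \<in> motzkin_words m. \<forall>i\<in>{1..<m}. s i = 1 \<or> s (Suc i) = -1 \<longleftrightarrow> odd (i + c)}"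

definition pair_sums :: "nat \<Rightarrow> nat \<Rightarrow> (nat \<Rightarrow> int) \<Rightarrow> (int \<times> int) list" where
  "pair_sums n c s = map (\<lambda>k. (1, s (2 * k + c + 1) + s (2 * k + c + 2))) [0..<n]"

text \<open>Inverse of \<open>pair_sums\<close>: the steps 1, 0, -1 become the pairs (1, 0), (1,
  -1), (0, -1). The first position of each pair is the one with i + c odd.\<close>

definition expand :: "nat \<Rightarrow> nat \<Rightarrow> (int \<times> int) list \<Rightarrow> nat \<Rightarrow> int" where
  "expand n c w i =
     (let y = snd (w ! ((i - c - 1) div 2))
      in if i \<le> c \<or> 2 * n + c < i then 0
         else if even (i + c) then (if y \<le> 0 then -1 else 0)
         else (if 0 \<le> y then 1 else 0))"

lemma snd_sum_list: "snd (sum_list w) = sum_list (map snd w)"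
  by (induction w) auto

text \<open>Every step advances the first coordinate by 1, so the condition on that coordinate only
  fixes the length.\<close>

lemma motzkin_paths_eq:
  "motzkin_paths n =
     {w. length w = n \<and> set w \<subseteq> {(1, 1), (1, - 1), (1, 0)} \<and> snd (sum_list w) = 0 \<and>
         (\<forall>k\<le>n. 0 \<le> snd (sum_list (take k w)))}"
proof -
  have "fst (sum_list w) = int (length w)"
    if "set w \<subseteq> {(1, 1), (1, - 1), (1, 0)}" for w :: "(int \<times> int) list"
    using that by (induction w) auto
  then show ?thesis
    by (auto simp: motzkin_paths_def prod_eq_iff)
qed

lemma index_cases:
  fixes i c n :: nat
  obtains "i \<le> c \<or> 2 * n + c < i"
  | k where "k < n" "i = 2 * k + c + 1"
  | k where "k < n" "i = 2 * k + c + 2"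
proof -
  consider "i \<le> c \<or> 2 * n + c < i"
    | "c < i" "i \<le> 2 * n + c" "i - c = 2 * ((i - c - 1) div 2) + 1"
    | "c < i" "i \<le> 2 * n + c" "i - c = 2 * ((i - c - 1) div 2) + 2" by linarith
  then show thesis
  proof cases
    case 1
    then show ?thesis by (rule that(1))
  next
    case 2
    then show ?thesis by (intro that(2)[of "(i - c - 1) div 2"]) linarith+
  next
    case 3
    then show ?thesis by (intro that(3)[of "(i - c - 1) div 2"]) linarith+
  qed
qed

lemma height_eq_pair_sums:
  assumes "\<And>i. i \<le> c \<Longrightarrow> s i = 0"
  shows "height s (2 * k + c) = (\<Sum>j<k. s (2 * j + c + 1) + s (2 * j + c + 2))"
proof (induction k)
  case 0
  then show ?case using assms by (simp add: height_def)
next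
  case (Suc k)
  have "height s (2 * Suc k + c) = height s (2 * k + c) + s (2 * k + c + 1) + s (2 * k + c + 2)"
    by simp
  with Suc show ?case by simp
qed

text \<open>Compression to pairs samples the height of the word at the pair boundaries.\<close>

lemma snd_sum_list_take_pair_sums:
  assumes "\<And>i. i \<le> c \<Longrightarrow> s i = 0" "k \<le> n"
  shows "snd (sum_list (take k (pair_sums n c s))) = height s (2 * k + c)"
  using assms(2) height_eq_pair_sums[of c s k, OF assms(1)]
  by (simp add: snd_sum_list pair_sums_def take_map comp_def interv_sum_list_conv_sum_set_nat atLeast0LessThan snd_sum)

text \<open>The four families at once: (c, m) is (0, 2n) or (0, 2n + 1) in the reverse alternating
  case and (1, 2n + 1) or (1, 2n + 2) in the alternating case. There are n pairs, a leading extra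
  position if c = 1, and a trailing one if m = 2n + c + 1.\<close>

context
  fixes n c m :: nat
  assumes c: "c \<le> 1" and m: "m = 2 * n + c \<or> m = 2 * n + c + 1"
begin

text \<open>A 1 at i forces a descent at i, and a -1 at i forces one at i - 1; parity forbids both.
  At the ends of the word, a final 1 or an initial -1 would put the path below the axis.\<close>

lemma alternating_word_signs:
  assumes s: "s \<in> alternating_words c m" and "1 \<le> i"
  shows "even (i + c) \<Longrightarrow> s i \<noteq> 1" "odd (i + c) \<Longrightarrow> s i \<noteq> -1"
proof -
  have h: "0 \<le> height s j" "height s m = 0" for j
    using s by (auto simp: alternating_words_def motzkin_words_def)
  have out: "s j = 0" if "m < j" for j
    using s that by (auto simp: alternating_words_def motzkin_words_def)
  have alt: "s j = 1 \<or> s (Suc j) = -1 \<longleftrightarrow> odd (j + c)" if "1 \<le> j" "j < m" for j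
    using s that by (auto simp: alternating_words_def)
  show "s i \<noteq> 1" if "even (i + c)"
  proof (cases i m rule: linorder_cases)
    case less
    then show ?thesis using alt[of i] \<open>1 \<le> i\<close> that by blast
  next
    case equal
    then show ?thesis using height_step[OF \<open>1 \<le> i\<close>, of s] h(1)[of "i - 1"] h(2) by auto
  qed (simp add: out)
  show "s i \<noteq> -1" if "odd (i + c)"
  proof (cases "i = 1")
    case True
    then show ?thesis using height_step[of 1 s] h(1)[of 1] by auto
  next
    case False
    with \<open>1 \<le> i\<close> obtain j where j: "i = Suc j" "1 \<le> j" by (cases i) auto
    show ?thesis
      using alt[of j] out[of i] j that by (cases "j < m") auto
  qed
qed

text \<open>The descent at the first position makes one of the two letters nonzero, and the sign
  restrictions leave three pairs. Their sums 0, 1, -1 are distinct, so a pair can be recovered from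
  its sum.\<close>

lemma alternating_word_pairs:
  assumes s: "s \<in> alternating_words c m" and "k < n"
  shows "(s (2 * k + c + 1), s (2 * k + c + 2)) \<in> {(1, -1), (1, 0), (0, -1)}"
proof -
  have signs: "s i \<in> {-1, 0, 1}" for i
    using s by (auto simp: alternating_words_def motzkin_words_def)
  have "2 * k + c + 1 < m" using m \<open>k < n\<close> by auto
  then have "s (2 * k + c + 1) = 1 \<or> s (2 * k + c + 2) = -1"
    using s by (auto simp: alternating_words_def)
  then show ?thesis
    using alternating_word_signs[OF s, of "2 * k + c + 1"] alternating_word_signs[OF s, of "2 * k + c + 2"]
      signs[of "2 * k + c + 1"] signs[of "2 * k + c + 2"] by auto
qed

lemma alternating_word_outside:
  assumes s: "s \<in> alternating_words c m" and i: "i \<le> c \<or> 2 * n + c < i"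
  shows "s i = 0"
proof (rule ccontr)
  assume nz: "s i \<noteq> 0"
  then have range: "1 \<le> i" "i \<le> m" and sign: "s i = 1 \<or> s i = -1"
    using s by (force simp: alternating_words_def motzkin_words_def)+
  have h: "0 \<le> height s j" "height s m = 0" for j
    using s by (auto simp: alternating_words_def motzkin_words_def)
  \<comment> \<open>Only the extra first or last position remains. Parity excludes one sign there;
    the other would start the path below the axis or end it above.\<close>
  from i c m range consider "i = 1" "c = 1" | "i = m" "m = 2 * n + c + 1" by linarith
  then show False
  proof cases
    case 1
    then show False
      using sign alternating_word_signs(1)[OF s, of i] height_step[of 1 s] h(1)[of 1] by auto
  next
    case 2
    then show False
      using sign alternating_word_signs(2)[OF s, of i] height_step[of m s] h(1)[of "m - 1"] h(2) by auto
  qed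
qed

lemma pair_sums_in_motzkin_paths:
  assumes s: "s \<in> alternating_words c m"
  shows "pair_sums n c s \<in> motzkin_paths n"
proof -
  have len: "length (pair_sums n c s) = n" by (simp add: pair_sums_def)
  have zero: "s i = 0" if "i \<le> c" for i
    using alternating_word_outside[OF s] that by blast
  have sums: "snd (sum_list (take k (pair_sums n c s))) = height s (2 * k + c)" if "k \<le> n" for k
    using zero that by (rule snd_sum_list_take_pair_sums)
  have "height s (2 * n + c) = height s m"
    using m alternating_word_outside[OF s, of "2 * n + c + 1"] by auto
  also have "\<dots> = 0" using s by (auto simp: alternating_words_def motzkin_words_def)
  finally have "snd (sum_list (pair_sums n c s)) = 0"
    using sums[of n] len by simp
  moreover have "set (pair_sums n c s) \<subseteq> {(1, 1), (1, - 1), (1, 0)}"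
    using alternating_word_pairs[OF s] by (fastforce simp: pair_sums_def)
  moreover have "\<forall>k\<le>n. 0 \<le> snd (sum_list (take k (pair_sums n c s)))"
    using s by (auto simp: sums alternating_words_def motzkin_words_def)
  ultimately show ?thesis using len by (simp add: motzkin_paths_eq)
qed

lemma expand_pair:
  assumes "k < n"
  shows "expand n c w (2 * k + c + 1) = (if 0 \<le> snd (w ! k) then 1 else 0)"
    and "expand n c w (2 * k + c + 2) = (if snd (w ! k) \<le> 0 then -1 else 0)"
  using assms by (simp_all add: expand_def)

lemma expand_outside: "i \<le> c \<or> 2 * n + c < i \<Longrightarrow> expand n c w i = 0"
  by (auto simp: expand_def)

lemma expand_pair_sums:
  assumes s: "s \<in> alternating_words c m"
  shows "expand n c (pair_sums n c s) = s"
proof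
  fix i
  have nth: "pair_sums n c s ! k = (1, s (2 * k + c + 1) + s (2 * k + c + 2))" if "k < n" for k
    using that by (simp add: pair_sums_def)
  show "expand n c (pair_sums n c s) i = s i"
  proof (cases rule: index_cases[where i = i and c = c and n = n])
    case 1
    then show ?thesis using expand_outside alternating_word_outside[OF s] by metis
  next
    case (2 k)
    then show ?thesis
      unfolding 2(2) expand_pair(1)[OF 2(1)] nth[OF 2(1)]
      using alternating_word_pairs[OF s 2(1)] by auto
  next
    case (3 k)
    then show ?thesis
      unfolding 3(2) expand_pair(2)[OF 3(1)] nth[OF 3(1)]
      using alternating_word_pairs[OF s 3(1)] by auto
  qed
qed

lemma pair_sums_expand:
  assumes w: "w \<in> motzkin_paths n"
  shows "pair_sums n c (expand n c w) = w"
proof (rule nth_equalityI)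
  have len: "length w = n" using w by (simp add: motzkin_paths_eq)
  then show "length (pair_sums n c (expand n c w)) = length w" by (simp add: pair_sums_def)
  fix k assume "k < length (pair_sums n c (expand n c w))"
  then have k: "k < n" by (simp add: pair_sums_def)
  then have "w ! k \<in> {(1, 1), (1, - 1), (1, 0)}"
    using w nth_mem[of k w] len unfolding motzkin_paths_eq by blast
  moreover have "pair_sums n c (expand n c w) ! k =
      (1, expand n c w (2 * k + c + 1) + expand n c w (2 * k + c + 2))"
    using k by (simp add: pair_sums_def)
  ultimately show "pair_sums n c (expand n c w) ! k = w ! k"
    unfolding expand_pair[OF k] by auto
qed

lemma expand_in_alternating_words:
  assumes w: "w \<in> motzkin_paths n"
  shows "expand n c w \<in> alternating_words c m"
proof -
  let ?s = "expand n c w"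
  have path: "length w = n" "snd (sum_list w) = 0"
    "\<And>k. k \<le> n \<Longrightarrow> 0 \<le> snd (sum_list (take k w))"
    using w by (auto simp: motzkin_paths_eq)
  have even_height: "height ?s (2 * k + c) = snd (sum_list (take k w))" if "k \<le> n" for k
    using snd_sum_list_take_pair_sums[of c ?s k n] that pair_sums_expand[OF w] expand_outside by simp
  have final: "height ?s (2 * n + c) = 0"
    using even_height[of n] path by simp
  have beyond: "height ?s j = 0" if "2 * n + c \<le> j" for j
    using that
  proof (induction j rule: dec_induct)
    case (step j)
    then show ?case using expand_outside[of "Suc j" w] by simp
  qed (rule final)
  \<comment> \<open>At pair boundaries the heights are those of w; inside a pair the height is that
    of the preceding boundary plus 0 or 1.\<close>
  have nonneg: "0 \<le> height ?s j" for j
  proof (cases rule: index_cases[where i = j and c = c and n = n])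
    case 1
    then show ?thesis
      using beyond[of j] expand_outside by (auto simp: height_def)
  next
    case (2 k)
    then have "height ?s j = height ?s (2 * k + c) + ?s (2 * k + c + 1)" by simp
    then show ?thesis
      using even_height[of k] path(3)[of k] expand_pair(1)[OF 2(1), of w] 2(1) by auto
  next
    case (3 k)
    then have "j = 2 * Suc k + c" by simp
    then show ?thesis using even_height[of "Suc k"] path(3)[of "Suc k"] 3(1) by simp
  qed
  have "?s i \<in> {-1, 0, 1}" for i
    by (auto simp: expand_def Let_def)
  moreover have "?s i = 0" if "i \<notin> {1..m}" for i
    using that m by (intro expand_outside) auto
  moreover have "height ?s m = 0"
    using beyond[of m] m by linarith
  \<comment> \<open>If i + c is even, i is never assigned 1 and i + 1 never -1. Otherwise i begins a
    pair, and any step y satisfies 0 \<le> y or y \<le> 0, so the pair has a suitable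
    letter.\<close>
  moreover have "?s i = 1 \<or> ?s (Suc i) = -1 \<longleftrightarrow> odd (i + c)" if "1 \<le> i" "i < m" for i
  proof (cases "even (i + c)")
    case True
    then show ?thesis by (auto simp: expand_def Let_def)
  next
    case False
    obtain k where k: "k < n" "i = 2 * k + c + 1"
    proof (cases rule: index_cases[where i = i and c = c and n = n])
      case 1
      then have "i = c \<and> c = 1" using c m \<open>1 \<le> i\<close> \<open>i < m\<close> by linarith
      with False show thesis by simp
    next
      case (2 k)
      then show thesis by (rule that)
    next
      case (3 k)
      with False show thesis by simp
    qed
    have "?s (Suc i) = (if snd (w ! k) \<le> 0 then -1 else 0)"
      using expand_pair(2)[OF k(1), of w] k(2) by simp
    then show ?thesis
      using False expand_pair(1)[OF k(1), of w] k(2) by auto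
  qed
  ultimately show ?thesis
    using nonneg by (simp add: alternating_words_def motzkin_words_def)
qed

lemma card_alternating_words: "card (alternating_words c m) = motzkin n"
  unfolding motzkin_def
proof (rule bij_betw_same_card, rule bij_betw_byWitness)
  show "\<forall>s\<in>alternating_words c m. expand n c (pair_sums n c s) = s"
    by (simp add: expand_pair_sums)
  show "\<forall>w\<in>motzkin_paths n. pair_sums n c (expand n c w) = w"
    by (simp add: pair_sums_expand)
qed (auto intro: pair_sums_in_motzkin_paths expand_in_alternating_words)

lemma card_noncrossing_descents:
  "card {\<pi> \<in> noncrossing_involutions m. \<forall>i\<in>{1..<m}. \<pi> (Suc i) < \<pi> i \<longleftrightarrow> odd (i + c)} = motzkin n"
    (is "card ?X = _")
proof -
  \<comment> \<open>Expressing the descent condition through signs alone lets the bijection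
    \<open>dirs\<close> carry it over to words.\<close>
  define P where "P s \<longleftrightarrow> (\<forall>i\<in>{1..<m}. s i = 1 \<or> s (Suc i) = -1 \<longleftrightarrow> odd (i + c))" for s :: "nat \<Rightarrow> int"
  have X: "?X = {\<pi> \<in> noncrossing_involutions m. P (dirs \<pi>)}"
    unfolding P_def using noncrossing_descent_iff[of _ m] by (intro Collect_cong conj_cong refl) simp
  have "alternating_words c m = {s \<in> dirs ` noncrossing_involutions m. P s}"
    by (simp only: alternating_words_def P_def bij_betw_imp_surj_on[OF bij_betw_dirs])
  also have "\<dots> = dirs ` ?X"
    unfolding X by blast
  finally have "card ?X = card (alternating_words c m)"
    using card_image[OF inj_on_subset[OF inj_on_dirs, of ?X m]] by force
  then show ?thesis
    by (simp only: card_alternating_words)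
qed

end

section \<open>Back to pattern avoidance\<close>

lemma noncrossing_involutions_eq:
  "noncrossing_involutions m =
     {\<pi>. \<pi> permutes {1..m} \<and> \<pi> = inv \<pi> \<and> \<not> contains_pattern m \<pi> [3, 4, 1, 2]}"
  unfolding noncrossing_involutions_def
  by (intro Collect_cong conj_cong refl) (rule avoids_3412_iff_noncrossing[symmetric])

lemma RAI_avoiding_3412_eq:
  "RAI_avoiding m [3, 4, 1, 2] =
     {\<pi> \<in> noncrossing_involutions m. \<forall>i\<in>{1..<m}. \<pi> (Suc i) < \<pi> i \<longleftrightarrow> odd (i + 0)}"
proof -
  have "reverse_alternating m \<pi> \<longleftrightarrow> (\<forall>i\<in>{1..<m}. \<pi> (Suc i) < \<pi> i \<longleftrightarrow> odd (i + 0))" for \<pi>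
    by (simp add: reverse_alternating_def)
  then show ?thesis
    unfolding RAI_avoiding_def RAI_def noncrossing_involutions_eq by blast
qed

text \<open>Neighbouring values differ, so an ascent is the failure of a descent, which shifts the
  parity by one.\<close>

lemma AI_avoiding_3412_eq:
  "AI_avoiding m [3, 4, 1, 2] =
     {\<pi> \<in> noncrossing_involutions m. \<forall>i\<in>{1..<m}. \<pi> (Suc i) < \<pi> i \<longleftrightarrow> odd (i + 1)}"
proof -
  have "alternating m \<pi> \<longleftrightarrow> (\<forall>i\<in>{1..<m}. \<pi> (Suc i) < \<pi> i \<longleftrightarrow> odd (i + 1))"
    if "\<pi> permutes {1..m}" for \<pi>
  proof -
    have "\<pi> i < \<pi> (i + 1) \<longleftrightarrow> \<not> \<pi> (Suc i) < \<pi> i" for i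
      using inj_eq[OF permutes_inj[OF that], of i "Suc i"] by auto
    then show ?thesis by (simp add: alternating_def)
  qed
  then show ?thesis
    unfolding AI_avoiding_def AI_def noncrossing_involutions_eq by blast
qed

theorem theorem6p1:
  fixes n :: nat
  shows "card (RAI_avoiding (2 * n) [3, 4, 1, 2]) = card (AI_avoiding (2 * n + 2) [3, 4, 1, 2])
       \<and> card (AI_avoiding (2 * n + 2) [3, 4, 1, 2]) = card (AI_avoiding (2 * n + 1) [3, 4, 1, 2])
       \<and> card (AI_avoiding (2 * n + 1) [3, 4, 1, 2]) = card (RAI_avoiding (2 * n + 1) [3, 4, 1, 2])
       \<and> card (RAI_avoiding (2 * n + 1) [3, 4, 1, 2]) = motzkin n"
  using card_noncrossing_descents[of 0 "2 * n" n] card_noncrossing_descents[of 0 "2 * n + 1" n]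
    card_noncrossing_descents[of 1 "2 * n + 1" n] card_noncrossing_descents[of 1 "2 * n + 2" n]
  unfolding RAI_avoiding_3412_eq AI_avoiding_3412_eq by linarith

end
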